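(* Let $k \geq 2$ be an integer. If $n \geq (k+2)^k$ is an integer, then $$c(n,k) \leq k \lceil n^{1/k} \rceil + k^2.$$
   Context: For an integer $n$, $C_n$ denotes the cycle with vertex set $\{1,2,\dots,n\}$ and edges $\{i,i+1\}$ for $1 \leq i \leq n-1$ together with $\{n,1\}$. A chord of $C_n$ is an edge joining two non-adjacent vertices of $C_n$. For integers $n \geq 6$ and $k \geq 2$, $c(n,k)$ denotes the minimum number of chords that must be added to $C_n$ so that the resulting graph has the property that for every integer $l \in \{k, k+1, \dots, n\}$ there is a cycle of length $l$ containing exactly $k$ of the added chords.
   Formalization: For k = 2 the length l = 2 is dropped from the requirement defining c(n,k), since a simple graph has no cycle of length 2 and c(n,2) would otherwise be a minimum over an empty set; for k ≥ 3 nothing changes. *)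

theory Defs
  imports Complex_Main "HOL-Library.Extended_Nat"
begin

text \<open>Undirected edges are two-element sets of vertices.\<close>

definition cycle_graph_edges :: "nat \<Rightarrow> nat set set" where
  "cycle_graph_edges n = {{i, i + 1} | i. 1 \<le> i \<and> i \<le> n - 1} \<union> {{n, 1}}"

definition chords :: "nat \<Rightarrow> nat set set" where
  "chords n = {{u, v} | u v. u \<in> {1..n} \<and> v \<in> {1..n} \<and> u \<noteq> v \<and> {u, v} \<notin> cycle_graph_edges n}"

text \<open>A cycle is represented by the list of its vertices in cyclic order.\<close>

definition cyclic_edges :: "'a list \<Rightarrow> 'a set set" where
  "cyclic_edges vs = {{vs ! i, vs ! ((i + 1) mod length vs)} | i. i < length vs}"

definition is_cycle :: "'a set set \<Rightarrow> 'a list \<Rightarrow> bool" where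
  "is_cycle E vs \<longleftrightarrow> 3 \<le> length vs \<and> distinct vs \<and> cyclic_edges vs \<subseteq> E"

text \<open>The guard \<open>3 \<le> l\<close> only matters for \<open>k = 2\<close>: it drops the value \<open>l = 2\<close>, since a simple
  graph has no cycle of length 2.\<close>

definition all_lengths_with_chords :: "nat \<Rightarrow> nat \<Rightarrow> nat set set \<Rightarrow> bool" where
  "all_lengths_with_chords n k S \<longleftrightarrow>
     (\<forall>l \<in> {k..n}. 3 \<le> l \<longrightarrow>
        (\<exists>vs. is_cycle (cycle_graph_edges n \<union> S) vs \<and> length vs = l \<and>
              card (cyclic_edges vs \<inter> S) = k))"

text \<open>The minimum is taken in \<open>enat\<close>, so that it is \<open>\<infinity>\<close>, rather than an arbitrary number, if no
  set of chords has the property.\<close>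

definition c :: "nat \<Rightarrow> nat \<Rightarrow> enat" where
  "c n k = (INF S \<in> {S. S \<subseteq> chords n \<and> all_lengths_with_chords n k S}. enat (card S))"

end

theory Submission
  imports Defs
begin

text \<open>Put \<open>b = \<lceil>n\<^bsup>1/k\<^esup>\<rceil>\<close> and cut the cycle into \<open>k\<close> arcs, numbered from \<open>0\<close>, the \<open>i\<close>-th one having
  \<open>(b - 1) b\<^bsup>i\<^esup> + 2\<close> edges and the last one taking what is left. On each arc, a chord from its
  initial vertex leaves \<open>r\<close> edges of the arc to be walked, where \<open>r\<close> ranges over the multiples
  \<open>d b\<^bsup>i\<^esup>\<close> with \<open>d < b\<close>, suitably truncated on the last arc. One chord from each arc gives a cycle with \<open>k\<close> chords,
  and by writing numbers in base \<open>b\<close> one obtains all lengths from \<open>k\<close> to \<open>n - k\<close> from \<open>k b\<close> chords.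
  Each of the remaining \<open>k\<close> lengths \<open>n - t\<close> is realised by \<open>k\<close> chords of its own: the cycle
  zigzags through \<open>1, 3, 5, \<dots>, 6, 4, 2\<close> on the first \<open>k + 1\<close> vertices, and jumps over \<open>t\<close> vertices.
  Edges of \<open>C\<^sub>n\<close> are not chords, so the different chord sets do not interfere.\<close>

section \<open>Edges of paths and cycles\<close>

fun path_edges :: "'a list \<Rightarrow> 'a set set" where
  "path_edges (x # y # zs) = insert {x, y} (path_edges (y # zs))"
| "path_edges _ = {}"

lemma path_edges_Cons: "ys \<noteq> [] \<Longrightarrow> path_edges (x # ys) = insert {x, hd ys} (path_edges ys)"
  by (cases ys) auto

lemma path_edges_append:
  "xs \<noteq> [] \<Longrightarrow> ys \<noteq> [] \<Longrightarrow>
    path_edges (xs @ ys) = path_edges xs \<union> {{last xs, hd ys}} \<union> path_edges ys"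
  by (induction xs) (auto simp: path_edges_Cons)

lemma path_edges_rev: "path_edges (rev xs) = path_edges xs"
proof (induction xs)
  case (Cons x xs)
  then show ?case
    by (cases "xs = []") (auto simp: path_edges_append path_edges_Cons last_rev insert_commute)
qed simp

lemma path_edges_map: "path_edges (map f xs) = (`) f ` path_edges xs"
  by (induction xs rule: path_edges.induct) auto

lemma path_edges_upt: "path_edges [a..<Suc b] = (\<lambda>i. {i, Suc i}) ` {a..<b}"
proof (induction b)
  case 0
  show ?case by (cases a) auto
next
  case (Suc b)
  show ?case
  proof (cases "a \<le> b")
    case True
    then have "path_edges [a..<Suc (Suc b)] = path_edges ([a..<Suc b] @ [Suc b])" by simp
    also have "\<dots> = path_edges [a..<Suc b] \<union> {{b, Suc b}}"
      using True by (subst path_edges_append) auto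
    also have "\<dots> = (\<lambda>i. {i, Suc i}) ` {a..<Suc b}"
      using True by (subst Suc.IH) (auto simp: atLeastLessThanSuc)
    finally show ?thesis .
  qed (cases "a = Suc b"; simp)
qed

lemma path_edges_conv_nth: "path_edges xs = {{xs ! i, xs ! Suc i} | i. Suc i < length xs}"
proof (induction xs rule: path_edges.induct)
  case (1 x y zs)
  have "{{(x # y # zs) ! i, (x # y # zs) ! Suc i} | i. Suc i < length (x # y # zs)} =
    insert {x, y} {{(y # zs) ! i, (y # zs) ! Suc i} | i. Suc i < length (y # zs)}"
    (is "?L = ?R")
  proof (intro subset_antisym subsetI)
    fix e assume "e \<in> ?L"
    then obtain i where "e = {(x # y # zs) ! i, (x # y # zs) ! Suc i}"
      "Suc i < length (x # y # zs)" by blast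
    then show "e \<in> ?R" by (cases i) auto
  next
    fix e assume "e \<in> ?R"
    then consider "e = {x, y}"
      | i where "e = {(y # zs) ! i, (y # zs) ! Suc i}" "Suc i < length (y # zs)" by blast
    then show "e \<in> ?L"
    proof cases
      case 1
      then show ?thesis by (intro CollectI exI[of _ 0]) auto
    next
      case (2 i)
      then show ?thesis by (intro CollectI exI[of _ "Suc i"]) auto
    qed
  qed
  with 1 show ?case by simp
qed auto

text \<open>Repeating the first vertex at the end removes the index arithmetic modulo the length, so
  cycles can be handled by concatenating paths.\<close>

lemma cyclic_edges_conv_path_edges:
  assumes "vs \<noteq> []"
  shows "cyclic_edges vs = path_edges (vs @ [hd vs])"
proof -
  have "(vs @ [hd vs]) ! i = vs ! i" "(vs @ [hd vs]) ! Suc i = vs ! ((i + 1) mod length vs)"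
    if "i < length vs" for i
    using that assms by (auto simp: nth_append hd_conv_nth) (use Suc_lessI in fastforce)+
  then show ?thesis
    unfolding cyclic_edges_def path_edges_conv_nth by auto metis+
qed

text \<open>Walks once around the cycle are written as increasing lists ending in \<open>n + 1\<close>, which stands
  for the vertex \<open>1\<close>.\<close>

definition wrap :: "nat \<Rightarrow> nat \<Rightarrow> nat" where
  "wrap n v = (if v = Suc n then 1 else v)"

lemma wrap_simps [simp]: "wrap n (Suc n) = 1" "v \<le> n \<Longrightarrow> wrap n v = v"
  by (auto simp: wrap_def)

lemma cyclic_edges_wrap:
  assumes "vs \<noteq> []" "hd vs = 1" "set vs \<subseteq> {..n}"
  shows "cyclic_edges vs = (`) (wrap n) ` path_edges (vs @ [Suc n])"
proof -
  have "map (wrap n) (vs @ [Suc n]) = vs @ [hd vs]"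
    using assms by (auto intro!: map_idI)
  then show ?thesis
    using assms(1) by (metis cyclic_edges_conv_path_edges path_edges_map)
qed

lemma cycle_edge_wrap:
  "1 \<le> i \<Longrightarrow> i \<le> n \<Longrightarrow> wrap n ` {i, Suc i} \<in> cycle_graph_edges n"
  by (cases "i = n") (auto simp: cycle_graph_edges_def)

text \<open>The last two hypotheses exclude what wrapping could produce: the edge
  \<open>{1, n}\<close> and a loop at \<open>1\<close> when \<open>u = 1\<close>, and the edge
  \<open>{2, 1}\<close> when \<open>u = 2\<close>.\<close>

lemma chord_wrap:
  assumes "1 \<le> u" "u + 2 \<le> v" "v \<le> Suc n" "u = 1 \<Longrightarrow> v < n" "u = 2 \<Longrightarrow> v \<le> n"
  shows "{u, wrap n v} \<in> chords n"
proof -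
  have "wrap n v \<in> {1..n}" "u \<noteq> wrap n v" "{u, wrap n v} \<notin> cycle_graph_edges n"
    using assms by (auto simp: wrap_def cycle_graph_edges_def doubleton_eq_iff)
  then show ?thesis
    using assms unfolding chords_def by force
qed

text \<open>The host graph has no chords besides \<open>T\<close>, and the cycle uses all of
  \<open>T\<close>; hence its chord count stays \<open>k\<close> when further chords are
  added.\<close>

definition cycle_with_chords :: "nat \<Rightarrow> nat \<Rightarrow> nat set set \<Rightarrow> nat \<Rightarrow> bool" where
  "cycle_with_chords n k T l \<longleftrightarrow> T \<subseteq> chords n \<and> card T = k \<and>
     (\<exists>vs. is_cycle (cycle_graph_edges n \<union> T) vs \<and> length vs = l \<and> T \<subseteq> cyclic_edges vs)"

text \<open>The chords added are those in \<open>A \<inter> chords n\<close>; each \<open>T\<close>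
  survives the intersection because it consists of chords.\<close>

lemma c_le_card:
  assumes "finite A"
    and "\<And>l. k \<le> l \<Longrightarrow> l \<le> n \<Longrightarrow> 3 \<le> l \<Longrightarrow> \<exists>T \<subseteq> A. cycle_with_chords n k T l"
  shows "c n k \<le> enat (card A)"
proof -
  let ?S = "A \<inter> chords n"
  have "all_lengths_with_chords n k ?S"
    unfolding all_lengths_with_chords_def
  proof (intro ballI impI)
    fix l assume "l \<in> {k..n}" "3 \<le> l"
    then obtain T vs where T: "T \<subseteq> ?S" "card T = k" and
      vs: "is_cycle (cycle_graph_edges n \<union> T) vs" "length vs = l" "T \<subseteq> cyclic_edges vs"
      using assms(2)[of l] unfolding cycle_with_chords_def by auto
    have "cycle_graph_edges n \<inter> ?S = {}"
      by (auto simp: chords_def)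
    with T vs have "cyclic_edges vs \<inter> ?S = T"
      by (auto simp: is_cycle_def)
    with T vs show "\<exists>vs. is_cycle (cycle_graph_edges n \<union> ?S) vs \<and> length vs = l \<and>
        card (cyclic_edges vs \<inter> ?S) = k"
      by (intro exI[of _ vs]) (auto simp: is_cycle_def)
  qed
  then have "c n k \<le> enat (card ?S)"
    unfolding c_def by (intro INF_lower) auto
  also have "\<dots> \<le> enat (card A)"
    using assms(1) by (simp add: card_mono)
  finally show ?thesis .
qed

section \<open>Cycles with one chord on each arc\<close>

text \<open>The arcs are delimited by the breakpoints \<open>p 0 < p 1 < \<dots>\<close>, and \<open>r i\<close> edges of the
  \<open>i\<close>-th arc are kept.\<close>

definition arc_path :: "(nat \<Rightarrow> nat) \<Rightarrow> (nat \<Rightarrow> nat) \<Rightarrow> nat \<Rightarrow> nat list" where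
  "arc_path p r m = concat (map (\<lambda>i. p i # [p (Suc i) - r i..<p (Suc i)]) [0..<m])"

lemma arc_path_Suc:
  "arc_path p r (Suc m) = arc_path p r m @ p m # [p (Suc m) - r m..<p (Suc m)]"
  by (simp add: arc_path_def)

lemma path_edges_arc_path_Suc:
  assumes "r m \<le> p (Suc m)"
  shows "path_edges (arc_path p r (Suc m) @ [p (Suc m)]) =
    path_edges (arc_path p r m @ [p m]) \<union> {{p m, p (Suc m) - r m}}
      \<union> (\<lambda>i. {i, Suc i}) ` {p (Suc m) - r m..<p (Suc m)}"
proof -
  have "arc_path p r (Suc m) @ [p (Suc m)] =
    (arc_path p r m @ [p m]) @ [p (Suc m) - r m..<Suc (p (Suc m))]"
    by (simp add: arc_path_Suc)
  moreover have "[p (Suc m) - r m..<Suc (p (Suc m))] \<noteq> []" by simp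
  ultimately show ?thesis
    by (simp add: path_edges_append[of "_ @ [_]"] path_edges_upt del: upt_Suc append_assoc)
qed

text \<open>One induction carries everything: distinctness of the next stretch needs all earlier
  vertices below \<open>p m\<close>. The breakpoint \<open>p m\<close> is appended only for the
  edges, since it opens the next arc or, at the end, stands for vertex \<open>1\<close>.\<close>

lemma arc_path_props:
  assumes "\<And>i. i < m \<Longrightarrow> p i + r i + 2 \<le> p (Suc i)"
  shows "length (arc_path p r m) = m + (\<Sum>i<m. r i) \<and> distinct (arc_path p r m) \<and>
    p 0 \<le> p m \<and> set (arc_path p r m) \<subseteq> {p 0..<p m} \<and>
    (\<lambda>i. {p i, p (Suc i) - r i}) ` {..<m} \<subseteq> path_edges (arc_path p r m @ [p m]) \<and>
    path_edges (arc_path p r m @ [p m]) \<subseteq>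
      (\<lambda>i. {p i, p (Suc i) - r i}) ` {..<m} \<union> (\<lambda>i. {i, Suc i}) ` {p 0..<p m}"
  using assms
proof (induction m)
  case 0
  show ?case by (simp add: arc_path_def)
next
  case (Suc m)
  have step: "p m + r m + 2 \<le> p (Suc m)" using Suc.prems by simp
  have IH: "length (arc_path p r m) = m + (\<Sum>i<m. r i)" "distinct (arc_path p r m)"
    "p 0 \<le> p m" "set (arc_path p r m) \<subseteq> {p 0..<p m}"
    "(\<lambda>i. {p i, p (Suc i) - r i}) ` {..<m} \<subseteq> path_edges (arc_path p r m @ [p m])"
    "path_edges (arc_path p r m @ [p m]) \<subseteq>
      (\<lambda>i. {p i, p (Suc i) - r i}) ` {..<m} \<union> (\<lambda>i. {i, Suc i}) ` {p 0..<p m}"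
    using Suc.IH[OF Suc.prems[OF less_SucI]] by blast+
  have edges: "path_edges (arc_path p r (Suc m) @ [p (Suc m)]) =
    path_edges (arc_path p r m @ [p m]) \<union> {{p m, p (Suc m) - r m}}
      \<union> (\<lambda>i. {i, Suc i}) ` {p (Suc m) - r m..<p (Suc m)}"
    using step by (intro path_edges_arc_path_Suc) simp
  have sub: "{p (Suc m) - r m..<p (Suc m)} \<subseteq> {p 0..<p (Suc m)}"
    "{p 0..<p m} \<subseteq> {p 0..<p (Suc m)}" using step IH(3) by auto
  show ?case
  proof (intro conjI)
    show "length (arc_path p r (Suc m)) = Suc m + (\<Sum>i<Suc m. r i)"
      using IH(1) step by (simp add: arc_path_Suc)
    show "distinct (arc_path p r (Suc m))"
    proof -
      have "x < p m" if "x \<in> set (arc_path p r m)" for x using that IH(4) by auto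
      then show ?thesis using IH(2) step by (force simp: arc_path_Suc)
    qed
    show "p 0 \<le> p (Suc m)"
      using IH(3) step by simp
    show "set (arc_path p r (Suc m)) \<subseteq> {p 0..<p (Suc m)}"
      using IH(3,4) step sub by (auto simp: arc_path_Suc)
    show "(\<lambda>i. {p i, p (Suc i) - r i}) ` {..<Suc m} \<subseteq>
        path_edges (arc_path p r (Suc m) @ [p (Suc m)])"
      using IH(5) unfolding edges lessThan_Suc image_insert by blast
    show "path_edges (arc_path p r (Suc m) @ [p (Suc m)]) \<subseteq>
        (\<lambda>i. {p i, p (Suc i) - r i}) ` {..<Suc m} \<union> (\<lambda>i. {i, Suc i}) ` {p 0..<p (Suc m)}"
      unfolding edges
    proof (intro Un_least)
      show "path_edges (arc_path p r m @ [p m]) \<subseteq>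
          (\<lambda>i. {p i, p (Suc i) - r i}) ` {..<Suc m} \<union> (\<lambda>i. {i, Suc i}) ` {p 0..<p (Suc m)}"
        using sub(2) by (intro order_trans[OF IH(6)] Un_mono image_mono) auto
      show "(\<lambda>i. {i, Suc i}) ` {p (Suc m) - r m..<p (Suc m)} \<subseteq>
          (\<lambda>i. {p i, p (Suc i) - r i}) ` {..<Suc m} \<union> (\<lambda>i. {i, Suc i}) ` {p 0..<p (Suc m)}"
        using sub(1) by (intro le_supI2 image_mono)
    qed simp
  qed
qed

lemma cycle_with_arc_chords:
  assumes "2 \<le> k" and p0: "p 0 = 1" and pk: "p k = Suc n"
    and step: "\<And>i. i < k \<Longrightarrow> p i + r i + 2 \<le> p (Suc i)"
    and three: "3 \<le> k + (\<Sum>i<k. r i)"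
  shows "cycle_with_chords n k ((\<lambda>i. {p i, wrap n (p (Suc i) - r i)}) ` {..<k}) (k + (\<Sum>i<k. r i))"
proof -
  let ?q = "\<lambda>i. p (Suc i) - r i"
  let ?chord = "\<lambda>i. {p i, wrap n (?q i)}"
  let ?vs = "arc_path p r k"
  have mono: "p i + 2 * (j - i) \<le> p j" if "i \<le> j" "j \<le> k" for i j
    using that
  proof (induction j rule: dec_induct)
    case (step j)
    with assms(4)[of j] show ?case by (simp add: Suc_diff_le)
  qed simp
  have pos: "1 \<le> p i" "p i \<le> n" "?q i \<le> Suc n" "p i + 2 \<le> ?q i" if "i < k" for i
    using mono[of 0 i] mono[of i k] mono[of "Suc i" k] step[of i] that p0 pk by auto
  have wrap_p: "wrap n (p i) = p i" if "i < k" for i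
    using pos[OF that] by simp
  have "?chord i \<in> chords n" if "i < k" for i
  proof (rule chord_wrap)
    \<comment> \<open>As \<open>k \<ge> 2\<close>, another arc of at least two edges follows the
      first, so the first chord ends before \<open>n\<close>. The case \<open>p i = 2\<close> below
      never occurs, as \<open>p 1 \<ge> 3\<close>.\<close>
    show "?q i < n" if "p i = 1"
    proof -
      have "i = 0" using mono[of 0 i] \<open>i < k\<close> p0 that by simp
      then show ?thesis using mono[of 1 k] assms(1) pk by simp
    qed
    show "?q i \<le> n" if "p i = 2"
      using mono[of 0 i] \<open>i < k\<close> p0 that mono[of 1 k] assms(1) pk by (cases i) auto
  qed (use pos[OF that] in auto)
  then have "?chord ` {..<k} \<subseteq> chords n" by auto
  moreover have "card (?chord ` {..<k}) = k"
  proof -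
    \<comment> \<open>Two chords can coincide only if one returns along the other: then
      \<open>k = 2\<close> and neither arc keeps an edge, a closed walk of length 2 that
      \<open>three\<close> excludes.\<close>
    have "?chord i \<noteq> ?chord j" if "i < j" "j < k" for i j
    proof
      assume "?chord i = ?chord j"
      moreover have "p i < p j" using mono[of i j] that by simp
      ultimately have eq: "p i = wrap n (?q j)" "p j = wrap n (?q i)"
        by (auto simp: doubleton_eq_iff)
      have "?q j = Suc n" "p i = 1"
        using eq(1) pos[of j] \<open>p i < p j\<close> that by (auto simp: wrap_def split: if_splits)
      then have "i = 0" using mono[of 0 i] that p0 by simp
      have "p (Suc j) = Suc n" "r j = 0"
        using \<open>?q j = Suc n\<close> mono[of "Suc j" k] pk that step[of j] by auto
      then have "Suc j = k"
        using mono[of "Suc j" k] pk that by simp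
      have "p j = ?q i"
        using eq(2) \<open>p i < p j\<close> \<open>p i = 1\<close> by (auto simp: wrap_def split: if_splits)
      then have "p (Suc i) = p j" "r i = 0"
        using mono[of "Suc i" j] that step[of i] by auto
      then have "Suc i = j"
        using mono[of "Suc i" j] that by simp
      with \<open>Suc j = k\<close> \<open>i = 0\<close> have "k = Suc (Suc 0)" "j = Suc 0" by auto
      with three \<open>r i = 0\<close> \<open>r j = 0\<close> \<open>i = 0\<close> show False by (simp add: lessThan_Suc)
    qed
    then have "inj_on ?chord {..<k}"
      by (intro inj_onI) (metis lessThan_iff nat_neq_iff)
    then show ?thesis by (simp add: card_image)
  qed
  moreover have "is_cycle (cycle_graph_edges n \<union> ?chord ` {..<k}) ?vs" and
    "?chord ` {..<k} \<subseteq> cyclic_edges ?vs"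
  proof -
    have props: "length ?vs = k + (\<Sum>i<k. r i)" "distinct ?vs" "set ?vs \<subseteq> {p 0..<p k}"
      "(\<lambda>i. {p i, ?q i}) ` {..<k} \<subseteq> path_edges (?vs @ [p k])"
      "path_edges (?vs @ [p k]) \<subseteq>
        (\<lambda>i. {p i, ?q i}) ` {..<k} \<union> (\<lambda>i. {i, Suc i}) ` {p 0..<p k}"
      using arc_path_props[of k p r, OF step] by blast+
    obtain k' where k': "k = Suc k'" using assms(1) by (cases k) auto
    have "hd ?vs = 1" "?vs \<noteq> []"
      unfolding k' arc_path_def by (simp_all add: upt_conv_Cons p0 del: upt_Suc)
    moreover have "set ?vs \<subseteq> {..n}" using props(3) pk by auto
    ultimately have ce: "cyclic_edges ?vs = (`) (wrap n) ` path_edges (?vs @ [Suc n])"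
      by (intro cyclic_edges_wrap)
    have chord_eq: "?chord ` {..<k} = (`) (wrap n) ` (\<lambda>i. {p i, ?q i}) ` {..<k}"
      unfolding image_image by (intro image_cong) (auto simp: wrap_p)
    show "?chord ` {..<k} \<subseteq> cyclic_edges ?vs"
      unfolding ce chord_eq using props(4) pk by (intro image_mono) simp
    have "cyclic_edges ?vs \<subseteq> ?chord ` {..<k} \<union> (`) (wrap n) ` (\<lambda>i. {i, Suc i}) ` {1..<Suc n}"
      unfolding ce chord_eq image_Un[symmetric] using props(5) pk p0 by (intro image_mono) simp
    moreover have "(`) (wrap n) ` (\<lambda>i. {i, Suc i}) ` {1..<Suc n} \<subseteq> cycle_graph_edges n"
      using cycle_edge_wrap by (auto simp del: image_insert)
    ultimately show "is_cycle (cycle_graph_edges n \<union> ?chord ` {..<k}) ?vs"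
      unfolding is_cycle_def using props(1,2) three by auto
  qed
  ultimately show ?thesis
    unfolding cycle_with_chords_def using arc_path_props[of k p r, OF step] by blast
qed

section \<open>Zigzag cycles\<close>

text \<open>The path \<open>m, m + 2, m + 4, \<dots>, m + 3, m + 1\<close> through \<open>{m..m + j + 1}\<close>.\<close>

primrec zigzag :: "nat \<Rightarrow> nat \<Rightarrow> nat list" where
  "zigzag 0 m = [m, Suc m]"
| "zigzag (Suc j) m = m # rev (zigzag j (Suc m))"

lemma zigzag_not_Nil [simp]: "zigzag j m \<noteq> []"
  by (cases j) auto

lemma hd_zigzag [simp]: "hd (zigzag j m) = m"
  by (cases j) auto

lemma last_zigzag [simp]: "last (zigzag j m) = Suc m"
  by (cases j) (auto simp: last_rev)

lemma set_zigzag: "set (zigzag j m) = {m..m + j + 1}"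
  by (induction j arbitrary: m) auto

lemma distinct_zigzag: "distinct (zigzag j m)"
  by (induction j arbitrary: m) (auto simp: set_zigzag)

lemma length_zigzag: "length (zigzag j m) = j + 2"
  by (induction j arbitrary: m) auto

text \<open>The path moves in steps of two except at its turn, where it joins its two largest
  vertices. Reversal in the recursion makes \<open>m + 2\<close> the neighbour of
  \<open>m\<close>.\<close>

lemma path_edges_zigzag:
  "path_edges (zigzag j m) = insert {m + j, Suc (m + j)} ((\<lambda>i. {i, i + 2}) ` {m..<m + j})"
proof (induction j arbitrary: m)
  case (Suc j)
  have "{m..<m + Suc j} = insert m {Suc m..<Suc m + j}" by auto
  with Suc show ?case
    by (simp add: path_edges_Cons path_edges_rev hd_rev insert_commute)
qed simp

text \<open>The \<open>k - 1\<close> short chords belong to the zigzag on \<open>{1..k + 1}\<close>,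
  which ends at \<open>2\<close>; the long chord leaves \<open>2\<close> and skips the
  \<open>t\<close> vertices following \<open>k + 1\<close>.\<close>

definition zigzag_chords :: "nat \<Rightarrow> nat \<Rightarrow> nat set set" where
  "zigzag_chords k t = insert {2, k + 2 + t} ((\<lambda>i. {i, i + 2}) ` {1..<k})"

lemma card_zigzag_chords:
  assumes "2 \<le> k"
  shows "card (zigzag_chords k t) = k"
proof -
  have "inj_on (\<lambda>i::nat. {i, i + 2}) {1..<k}"
    by (auto simp: inj_on_def doubleton_eq_iff)
  then have "card ((\<lambda>i. {i, i + 2}) ` {1..<k}) = k - 1"
    by (simp add: card_image)
  moreover have "{2, k + 2 + t} \<notin> (\<lambda>i. {i, i + 2}) ` {1..<k}"
    by (auto simp: doubleton_eq_iff)
  ultimately show ?thesis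
    using assms by (simp add: zigzag_chords_def)
qed

lemma cycle_with_zigzag_chords:
  assumes "2 \<le> k" "k + 2 + t \<le> n"
  shows "cycle_with_chords n k (zigzag_chords k t) (n - t)"
proof -
  let ?vs = "zigzag (k - 1) 1 @ [k + 2 + t..<Suc n]"
  have chords: "zigzag_chords k t \<subseteq> chords n"
  proof -
    have "{i, i + 2} \<in> chords n" if "1 \<le> i" "i < k" for i
      using chord_wrap[of i "i + 2" n] that assms by simp
    moreover have "{2, k + 2 + t} \<in> chords n"
      using chord_wrap[of 2 "k + 2 + t" n] assms by simp
    ultimately show ?thesis by (auto simp: zigzag_chords_def)
  qed
  have wrap_chords: "(`) (wrap n) ` zigzag_chords k t = zigzag_chords k t"
    using assms unfolding zigzag_chords_def by (force simp: image_image intro!: image_cong)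
  have "cyclic_edges ?vs = (`) (wrap n) ` path_edges (?vs @ [Suc n])"
    using assms by (intro cyclic_edges_wrap) (auto simp: set_zigzag)
  also have "?vs @ [Suc n] = zigzag (k - 1) 1 @ [k + 2 + t..<Suc (Suc n)]"
    using assms by simp
  also have "path_edges \<dots> = zigzag_chords k t \<union>
      insert {k, Suc k} ((\<lambda>i. {i, Suc i}) ` {k + 2 + t..<Suc n})"
    using assms
    by (subst path_edges_append)
      (auto simp: path_edges_upt path_edges_zigzag zigzag_chords_def numeral_2_eq_2 simp del: upt_Suc)
  also have "(`) (wrap n) ` \<dots> = zigzag_chords k t \<union>
      (`) (wrap n) ` (insert {k, Suc k} ((\<lambda>i. {i, Suc i}) ` {k + 2 + t..<Suc n}))"
    by (simp only: image_Un wrap_chords)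
  finally have ce: "cyclic_edges ?vs = zigzag_chords k t \<union>
      (`) (wrap n) ` (insert {k, Suc k} ((\<lambda>i. {i, Suc i}) ` {k + 2 + t..<Suc n}))" .
  have "(`) (wrap n) ` (insert {k, Suc k} ((\<lambda>i. {i, Suc i}) ` {k + 2 + t..<Suc n}))
      \<subseteq> cycle_graph_edges n"
    using cycle_edge_wrap assms by (auto simp del: image_insert)
  moreover have "distinct ?vs"
    using assms by (auto simp: distinct_zigzag set_zigzag)
  moreover have len: "length ?vs = n - t"
    using assms by (simp add: length_zigzag del: upt_Suc)
  ultimately have "is_cycle (cycle_graph_edges n \<union> zigzag_chords k t) ?vs"
    using assms unfolding is_cycle_def ce by auto
  with chords card_zigzag_chords[OF assms(1)] ce len show ?thesis
    unfolding cycle_with_chords_def by blast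
qed

section \<open>Arithmetic\<close>

lemma base_representation:
  fixes b x :: nat
  assumes "x < b ^ m"
  shows "\<exists>d. (\<forall>i<m. d i < b) \<and> x = (\<Sum>i<m. d i * b ^ i)"
  using assms
proof (induction m arbitrary: x)
  case (Suc m)
  then have "b ^ m > 0" by (cases "b = 0") auto
  then obtain d where d: "\<forall>i<m. d i < b" "x mod b ^ m = (\<Sum>i<m. d i * b ^ i)"
    using Suc.IH[of "x mod b ^ m"] by auto
  have "x div b ^ m < b"
    using Suc.prems by (simp add: less_mult_imp_div_less)
  moreover have "x = (\<Sum>i<Suc m. (d(m := x div b ^ m)) i * b ^ i)"
    using d(2) mod_div_mult_eq[of x "b ^ m"] by simp
  ultimately show ?case
    using d(1) by (intro exI[of _ "d(m := x div b ^ m)"]) (auto simp: less_Suc_eq)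
qed simp

text \<open>A Bernoulli-type bound \<open>(a + 1) ^ m * (a - m) \<le> a ^ (m + 1)\<close>, combined
  with \<open>a - m \<ge> 2\<close>. With \<open>a = b - 1\<close> and \<open>m = k - 1\<close> it
  leaves room for the last arc.\<close>

lemma two_power_Suc_le:
  fixes a m :: nat
  assumes "m + 2 \<le> a"
  shows "2 * (a + 1) ^ m \<le> a ^ (m + 1)"
proof -
  have "(a + 1) ^ m * (a - m) \<le> a ^ (m + 1)" if "m \<le> a" for m
    using that
  proof (induction m)
    case (Suc m)
    then obtain e where e: "a = Suc m + e" using le_Suc_ex by blast
    have "(a + 1) * (a - Suc m) \<le> a * (a - m)"
      by (simp add: e algebra_simps)
    then have "(a + 1) ^ Suc m * (a - Suc m) \<le> a * ((a + 1) ^ m * (a - m))"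
      using mult_le_mono2[of _ _ "(a + 1) ^ m"] by (simp add: mult_ac del: mult_Suc mult_Suc_right)
    also have "\<dots> \<le> a * a ^ (m + 1)"
      using Suc by (intro mult_le_mono2) simp
    finally show ?case by simp
  qed simp
  from this[of m] have "(a + 1) ^ m * (a - m) \<le> a ^ (m + 1)" using assms by simp
  moreover have "2 * (a + 1) ^ m \<le> (a + 1) ^ m * (a - m)"
    using assms mult_le_mono2[of 2 "a - m" "(a + 1) ^ m"] by (simp add: mult.commute)
  ultimately show ?thesis by (rule order_trans[rotated])
qed

text \<open>The first bound permits the preceding estimate, the second limits the number of
  multiples on the last arc, and the third makes \<open>n\<close> large enough for that arc to
  fit.\<close>

lemma ceiling_root_bounds:
  fixes n k :: nat
  assumes "k \<ge> 2" "n \<ge> (k + 2) ^ k"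
  defines "b \<equiv> nat \<lceil>real n powr (1 / real k)\<rceil>"
  shows "k + 2 \<le> b" "n \<le> b ^ k" "(b - 1) ^ k < n"
proof -
  let ?x = "real n powr (1 / real k)"
  have n: "n > 0" using assms(2) by (cases n) auto
  have "?x ^ k = ?x powr real k"
    using n by (simp add: powr_realpow)
  also have "\<dots> = real n"
    using n assms(1) by (simp add: powr_powr)
  finally have xk: "?x ^ k = real n" .
  have "real (k + 2) ^ k \<le> ?x ^ k"
    unfolding xk using assms(2) by (metis of_nat_le_iff of_nat_power)
  then have kx: "real (k + 2) \<le> ?x"
    using assms(1) by (subst (asm) power_mono_iff) auto
  have xb: "?x \<le> real b"
    unfolding b_def by (rule real_nat_ceiling_ge)
  show kb: "k + 2 \<le> b" using kx xb by linarith
  have "?x ^ k \<le> real b ^ k"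
    using xb by (intro power_mono) auto
  then show "n \<le> b ^ k"
    unfolding xk by (metis of_nat_le_iff of_nat_power)
  have "real (b - 1) < ?x"
    using kb unfolding b_def by linarith
  then have "real (b - 1) ^ k < ?x ^ k"
    using assms(1) by (intro power_strict_mono) auto
  then show "(b - 1) ^ k < n"
    unfolding xk by (metis of_nat_less_iff of_nat_power)
qed

section \<open>The chord set\<close>

theorem theorem2:
  fixes n k :: nat
  assumes "k \<ge> 2"
    and "n \<ge> (k + 2) ^ k"
  shows "c n k \<le> enat (k * nat \<lceil>real n powr (1 / real k)\<rceil> + k ^ 2)"
proof -
  define b where "b = nat \<lceil>real n powr (1 / real k)\<rceil>"
  have kb: "k + 2 \<le> b" and n_le: "n \<le> b ^ k" and n_gt: "(b - 1) ^ k < n"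
    using ceiling_root_bounds[OF assms] by (simp_all add: b_def)
  define m where "m = k - 1"
  have k: "k = Suc m" and "1 \<le> m" using assms(1) by (auto simp: m_def)
  define B where "B = b ^ m"
  have "2 * B \<le> (b - 1) ^ k"
    using two_power_Suc_le[of m "b - 1"] kb by (simp add: k B_def)
  moreover have "2 * k \<le> B"
  proof -
    have "2 * k \<le> 1 + m * 3" using \<open>1 \<le> m\<close> k by simp
    also have "\<dots> \<le> 4 ^ m" by (induction m) auto
    also have "\<dots> \<le> B" unfolding B_def using kb assms(1) by (intro power_mono) auto
    finally show ?thesis .
  qed
  ultimately have n_ge: "B + 2 * k < n" using n_gt by simp
  \<comment> \<open>The last arc runs from \<open>B + 2 * m\<close> to \<open>n + 1\<close>; keeping
    \<open>top\<close> of its edges leaves exactly two for the chord to bypass.\<close>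
  define top where "top = n + 1 - B - 2 * k"
  have top: "top + B + 2 * k = n + 1" using n_ge by (simp add: top_def)
  define p where "p i = (if i < k then b ^ i + 2 * i else Suc n)" for i
  \<comment> \<open>The last arc is shorter than a full base-\<open>b\<close> arc. Its multiples of \<open>B\<close> stop below the largest
    admissible value \<open>top\<close>, which is added; as \<open>top < (b - 1) B\<close>, there are still at most \<open>b\<close> values.\<close>
  define R where "R i = (if i < m then (\<lambda>d. d * b ^ i) ` {..<b}
    else insert top ({r. r < top} \<inter> (\<lambda>d. d * B) ` {..<b - 1}))" for i
  define A where "A = (\<Union>i<k. (\<lambda>r. {p i, wrap n (p (Suc i) - r)}) ` R i) \<union>
    (\<Union>t<k. zigzag_chords k t)"
  have R: "finite (R i)" "card (R i) \<le> b" for i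
  proof -
    have "card ({r. r < top} \<inter> (\<lambda>d. d * B) ` {..<b - 1}) \<le> b - 1"
      by (rule order_trans[OF card_mono[of "(\<lambda>d. d * B) ` {..<b - 1}"]])
        (use card_image_le[of "{..<b - 1}" "\<lambda>d. d * B"] in auto)
    then show "card (R i) \<le> b"
      using card_image_le[of "{..<b}" "\<lambda>d. d * b ^ i"] kb
      by (auto simp: R_def card_insert_if)
  qed (auto simp: R_def)
  have A_fin: "finite A"
    using R(1) by (auto simp: A_def zigzag_chords_def)
  have "card A \<le> (\<Sum>i<k. b) + (\<Sum>t<k. k)"
    unfolding A_def
    by (intro order_trans[OF card_Un_le] add_mono order_trans[OF card_UN_le] sum_mono)
      (auto intro: order_trans[OF card_image_le] R simp: card_zigzag_chords assms(1))
  then have A_card: "card A \<le> k * b + k ^ 2"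
    by (simp add: power2_eq_square)
  have R_step: "p i + r + 2 \<le> p (Suc i)" if "i < k" "r \<in> R i" for i r
  proof (cases "i < m")
    case True
    then obtain d where d: "r = d * b ^ i" "d < b"
      using \<open>r \<in> R i\<close> by (auto simp: R_def)
    then have "(d + 1) * b ^ i \<le> b * b ^ i" by (intro mult_le_mono1) simp
    then show ?thesis using d True by (simp add: p_def k)
  next
    case False
    then have "i = m" "r \<le> top" using that by (auto simp: k R_def)
    then show ?thesis using top by (simp add: p_def k B_def)
  qed
  have sums: "\<exists>r. (\<forall>i<k. r i \<in> R i) \<and> s = (\<Sum>i<k. r i)" if "s < top + B" for s
  proof -
    \<comment> \<open>Greedy choice: the largest element of \<open>R m\<close> not exceeding
      \<open>s\<close>. The remainder is below \<open>B = b ^ m\<close>, so its \<open>m\<close>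
      digits in base \<open>b\<close> serve the other arcs.\<close>
    define u where "u = (if top \<le> s then top else s div B * B)"
    have "B > 0" using kb by (simp add: B_def)
    have "u \<le> s" "s - u < B"
      using that \<open>B > 0\<close> by (auto simp: u_def minus_div_mult_eq_mod)
    obtain d where d: "\<forall>i<m. d i < b" "s - u = (\<Sum>i<m. d i * b ^ i)"
      using base_representation[of "s - u" b m] \<open>s - u < B\<close> by (auto simp: B_def)
    have "u \<in> R m"
    proof (cases "top \<le> s")
      case False
      have "s div B * B < (b - 1) * B"
      proof -
        have "n \<le> b * B" using n_le by (simp add: k B_def)
        then have "top < (b - 1) * B"
          using top \<open>k \<ge> 2\<close> by (simp add: diff_mult_distrib)
        with False show ?thesis using div_times_less_eq_dividend[of s B] by linarith
      qed
      then have "s div B < b - 1" by (simp add: \<open>B > 0\<close>)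
      moreover have "s div B * B < top"
        using False div_times_less_eq_dividend[of s B] by linarith
      ultimately show ?thesis using False by (auto simp: R_def u_def)
    qed (simp add: R_def u_def)
    moreover define r where "r i = (if i < m then d i * b ^ i else u)" for i
    ultimately have "\<forall>i<k. r i \<in> R i"
      using d(1) by (auto simp: k less_Suc_eq r_def) (auto simp: R_def)
    moreover have "s = (\<Sum>i<k. r i)"
      using d(2) \<open>u \<le> s\<close> by (simp add: k r_def)
    ultimately show ?thesis by blast
  qed
  have "\<exists>T \<subseteq> A. cycle_with_chords n k T l" if "k \<le> l" "l \<le> n" "3 \<le> l" for l
  proof (cases "l + k \<le> n")
    case True
    \<comment> \<open>Since \<open>top + B = n + 1 - 2 * k\<close>, the range of \<open>sums\<close>
      reaches exactly up to \<open>l = n - k\<close>.\<close>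
    then have "l - k < top + B" using top that by linarith
    from sums[OF this] obtain r where r: "\<forall>i<k. r i \<in> R i" "l - k = (\<Sum>i<k. r i)"
      by blast
    have "cycle_with_chords n k ((\<lambda>i. {p i, wrap n (p (Suc i) - r i)}) ` {..<k})
        (k + (\<Sum>i<k. r i))"
    proof (rule cycle_with_arc_chords)
      show "p i + r i + 2 \<le> p (Suc i)" if "i < k" for i
        using R_step r(1) that by blast
    qed (use assms(1) that r(2) in \<open>auto simp: p_def\<close>)
    moreover have "k + (\<Sum>i<k. r i) = l" using r(2) that by simp
    moreover have "(\<lambda>i. {p i, wrap n (p (Suc i) - r i)}) ` {..<k} \<subseteq> A"
      using r(1) by (auto simp: A_def)
    ultimately show ?thesis by auto
  next
    case False
    \<comment> \<open>Here \<open>n - l < k\<close>, so the \<open>k\<close> zigzag sets in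
      \<open>A\<close> suffice; they account for the term \<open>k ^ 2\<close>.\<close>
    then have "cycle_with_chords n k (zigzag_chords k (n - l)) (n - (n - l))"
      using n_ge \<open>2 * k \<le> B\<close> assms(1) that by (intro cycle_with_zigzag_chords) auto
    moreover have "zigzag_chords k (n - l) \<subseteq> A"
      unfolding A_def using False assms(1) by (intro le_supI2 UN_upper) auto
    ultimately show ?thesis using that by auto
  qed
  then have "c n k \<le> enat (card A)"
    by (rule c_le_card[OF A_fin])
  also have "\<dots> \<le> enat (k * b + k ^ 2)"
    using A_card by simp
  finally show ?thesis by (simp add: b_def)
qed

end
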